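(* Let $X=\mathbb{R}^n$, $\mathbb{U}\subseteq\mathbb{R}^m$, $f:X\times\mathbb{U}\to X$, $\ell:X\times\mathbb{U}\to\mathbb{R}_{\ge0}$, and $\ell_{\min}(x):=\inf_{u\in\mathbb{U}}\ell(x,u)$. Suppose there exist constants $C_\ell\ge1$, $\rho\in[0,1)$ and a control law $\kappa:X\to\mathbb{U}$ such that for all $x\in X$, $k\in\mathbb{I}_{\ge0}$, $$\ell(x_u(k,x),u(k))\le C_\ell\rho^k\ell_{\min}(x),$$ where $u(k)=\kappa(x_u(k,x))$ is the input sequence generated by $\kappa$ from $x$. Consider $\sigma=\ell_{\min}$ and $V_{\mathrm{f}}(x)=\sum_{k=0}^{M-1}\ell(x_u(k,x),u(k))$ with $u(k)=\kappa(x_u(k,x))$ and some $M\in\mathbb{I}_{\ge1}$. Then the following terminal cost condition holds with $$\overline c_{\mathrm{f}}=\frac{1-\rho^M}{1-\rho}C_\ell,\qquad\underline c_{\mathrm{f}}=1,\qquad\epsilon_{\mathrm{f}}=C_\ell\frac{1-\rho}{\rho^{-M}-1}:$$ the constants satisfy $\underline c_{\mathrm{f}},\overline c_{\mathrm{f}},\epsilon_{\mathrm{f}}>0$ and, for any $x\in X$, $$\underline c_{\mathrm{f}}\sigma(x)\le V_{\mathrm{f}}(x)\le\overline c_{\mathrm{f}}\sigma(x),\qquad\min_{u\in\mathbb{U}}\{V_{\mathrm{f}}(f(x,u))+\ell(x,u)\}\le(1+\epsilon_{\mathrm{f}})V_{\mathrm{f}}(x),\qquad\underline c_{\mathrm{f}}\le\frac{\gamma_{1,\mathrm{f}}}{1+\epsilon_{\mathrm{f}}}\le\overline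 c_{\mathrm{f}},$$ where $\gamma_{1,\mathrm{f}}$ is the given constant of the cost controllability condition stated in the context.
   Context: $\mathbb{I}_{\ge a}$ denotes the integers $\ge a$. System $x(k+1)=f(x(k),u(k))$; $x_u(k,x)$ is the state after $k$ steps under the input sequence $u$ starting from $x_u(0,x)=x$. $V_{k,\mathrm{f}}(x)=\inf_{u\in\mathbb{U}^k}\left\{\sum_{j=0}^{k-1}\ell(x_u(j,x),u(j))+V_{\mathrm{f}}(x_u(k,x))\right\}$; minimizers are assumed to exist. Cost controllability condition: there are given constants $\overline\gamma_{\mathrm{f}}\ge0$ and $\gamma_{k,\mathrm{f}}\in[0,\overline\gamma_{\mathrm{f}}]$, $k\in\mathbb{I}_{\ge1}$, such that $V_{k,\mathrm{f}}(x)\le\gamma_{k,\mathrm{f}}\sigma(x)$ for all $x\in X$, $k\in\mathbb{I}_{\ge1}$.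
   Formalization: The range for γ_{1,f} fails for arbitrary given constants; shown instead: γ_{1,f} may be replaced by an admissible constant in range (kept if already in range; the common bound may grow). For ρ=0, ε_f is undefined and read as 0, so ε_f>0 is claimed only for ρ>0. *)

theory Defs
  imports "HOL-Analysis.Analysis"
begin

(* Dynamics, stage costs and feedback laws are total functions on the ambient spaces.  Their values
   at inputs outside the input set U are never used: every input below is drawn from U. *)

primrec trajectory ::
  "('x \<Rightarrow> 'u \<Rightarrow> 'x) \<Rightarrow> (nat \<Rightarrow> 'u) \<Rightarrow> 'x \<Rightarrow> nat \<Rightarrow> 'x" where
  "trajectory f u x 0 = x"
| "trajectory f u x (Suc k) = f (trajectory f u x k) (u k)"

(* The input sequence determined by u k = \<kappa> (trajectory f u x k); see feedback_input_eq. *)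
definition feedback_input ::
  "('x \<Rightarrow> 'u \<Rightarrow> 'x) \<Rightarrow> ('x \<Rightarrow> 'u) \<Rightarrow> 'x \<Rightarrow> nat \<Rightarrow> 'u" where
  "feedback_input f \<kappa> x k = \<kappa> (((\<lambda>y. f y (\<kappa> y)) ^^ k) x)"

lemma trajectory_feedback_input:
  "trajectory f (feedback_input f \<kappa> x) x k = ((\<lambda>y. f y (\<kappa> y)) ^^ k) x"
  by (induction k) (simp_all add: feedback_input_def)

lemma feedback_input_eq:
  "feedback_input f \<kappa> x k = \<kappa> (trajectory f (feedback_input f \<kappa> x) x k)"
  by (simp add: trajectory_feedback_input feedback_input_def)

(* U^k is represented by infinite sequences of which only the first k entries are constrained;
   the horizon-k cost depends on those entries only. *)
definition input_seqs :: "'u set \<Rightarrow> nat \<Rightarrow> (nat \<Rightarrow> 'u) set" where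
  "input_seqs U k = {u. \<forall>j<k. u j \<in> U}"

definition horizon_cost ::
  "('x \<Rightarrow> 'u \<Rightarrow> 'x) \<Rightarrow> ('x \<Rightarrow> 'u \<Rightarrow> real) \<Rightarrow> ('x \<Rightarrow> real) \<Rightarrow> nat \<Rightarrow> 'x \<Rightarrow> (nat \<Rightarrow> 'u) \<Rightarrow> real" where
  "horizon_cost f l Vf k x u =
     (\<Sum>j<k. l (trajectory f u x j) (u j)) + Vf (trajectory f u x k)"

(* The infima below are taken in the reals; they are the usual ones as soon as U is nonempty and
   the costs are nonnegative. *)
definition horizon_value ::
  "('x \<Rightarrow> 'u \<Rightarrow> 'x) \<Rightarrow> 'u set \<Rightarrow> ('x \<Rightarrow> 'u \<Rightarrow> real) \<Rightarrow> ('x \<Rightarrow> real) \<Rightarrow> nat \<Rightarrow> 'x \<Rightarrow> real" where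
  "horizon_value f U l Vf k x = (INF u\<in>input_seqs U k. horizon_cost f l Vf k x u)"

definition min_stage_cost :: "'u set \<Rightarrow> ('x \<Rightarrow> 'u \<Rightarrow> real) \<Rightarrow> 'x \<Rightarrow> real" where
  "min_stage_cost U l x = (INF u\<in>U. l x u)"

definition feedback_cost ::
  "('x \<Rightarrow> 'u \<Rightarrow> 'x) \<Rightarrow> ('x \<Rightarrow> 'u \<Rightarrow> real) \<Rightarrow> ('x \<Rightarrow> 'u) \<Rightarrow> nat \<Rightarrow> 'x \<Rightarrow> real" where
  "feedback_cost f l \<kappa> M x =
     (\<Sum>k<M. l (trajectory f (feedback_input f \<kappa> x) x k) (feedback_input f \<kappa> x k))"

definition minimizers_exist ::
  "('x \<Rightarrow> 'u \<Rightarrow> 'x) \<Rightarrow> 'u set \<Rightarrow> ('x \<Rightarrow> 'u \<Rightarrow> real) \<Rightarrow> ('x \<Rightarrow> real) \<Rightarrow> bool" where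
  "minimizers_exist f U l Vf \<longleftrightarrow>
     (\<forall>k\<ge>1. \<forall>x. \<exists>u. is_arg_min (horizon_cost f l Vf k x) (\<lambda>u. u \<in> input_seqs U k) u)"

definition cost_controllability ::
  "('x \<Rightarrow> 'u \<Rightarrow> 'x) \<Rightarrow> 'u set \<Rightarrow> ('x \<Rightarrow> 'u \<Rightarrow> real) \<Rightarrow> ('x \<Rightarrow> real) \<Rightarrow> ('x \<Rightarrow> real)
     \<Rightarrow> real \<Rightarrow> (nat \<Rightarrow> real) \<Rightarrow> bool" where
  "cost_controllability f U l Vf \<sigma> \<gamma>bar \<gamma> \<longleftrightarrow>
     0 \<le> \<gamma>bar \<and>
     (\<forall>k\<ge>1. 0 \<le> \<gamma> k \<and> \<gamma> k \<le> \<gamma>bar \<and> (\<forall>x. horizon_value f U l Vf k x \<le> \<gamma> k * \<sigma> x))"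

(* At \<rho> = 0 the expression C * (1 - \<rho>) / (\<rho>^(-M) - 1) is read as its limit 0
   (that is, 1 / 0 = \<infinity>); HOL division would yield -C for M > 0. *)
definition terminal_eps :: "real \<Rightarrow> real \<Rightarrow> nat \<Rightarrow> real" where
  "terminal_eps C \<rho> M =
     (if \<rho> = 0 then 0 else C * (1 - \<rho>) / (\<rho> powi (- int M) - 1))"

end

theory Submission
  imports Defs
begin

text \<open>
  Along the closed loop $x_{k+1} = f(x_k, \kappa(x_k))$ write $a_k = \ell(x_k, \kappa(x_k))$.
  Because $\sigma$ is an infimum over the inputs and $\kappa$ takes values in $U$,
  $\sigma(x_k) \le a_k$. Two-sided bounds on $V_f(x) = a_0 + \dots + a_{M-1}$ follow at once: the
  lower one from the term $a_0$, the upper one from the geometric decay of $a_k$.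

  The descent condition is tested at $u = \kappa(x)$. Because the closed loop started at
  $f(x, \kappa(x))$ is the shifted closed loop,
  $V_f(f(x,\kappa(x))) + \ell(x,\kappa(x)) = V_f(x) + a_M$. It remains to see
  $a_M \le \epsilon_f V_f(x)$. Estimating $a_M$ by $\sigma(x)$ alone is too weak for $M \ge 2$; the
  stated constant arises by restarting the decay estimate at every intermediate state:
  $a_M \le C \rho^{M-k} \sigma(x_k) \le C \rho^{M-k} a_k$ for each $k < M$. So, for $\rho > 0$, every $a_k$ is at
  least a multiple of $a_M$ that grows as $k$ decreases, and summing these geometric lower bounds
  gives the claim (\<open>terminal_eps_bound\<close>). Existence of the minimum is the existence
  of minimizers for horizon $1$, whose cost is the function minimized in the descent condition
  (\<open>one_step_minimizer\<close>).

  Finally, combining the descent condition with the upper bound on $V_f$ gives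
  $V_{1,f}(x) \le (1+\epsilon_f)\, \overline c_f\, \sigma(x)$. Hence the constant
  $(1+\epsilon_f)\,\overline c_f$ is always admissible as $\gamma_{1,f}$ and lies in the required
  range since $\overline c_f \ge 1$; a given $\gamma_{1,f}$ already in that range can be kept.
\<close>

section \<open>Geometric constants\<close>

text \<open>Clearing the negative power gives one formula that also covers $\rho = 0$, so later
  arguments need no case distinction.\<close>

lemma terminal_eps_eq:
  assumes "0 \<le> \<rho>" "\<rho> < 1" "1 \<le> M"
  shows "terminal_eps C \<rho> M = C * (1 - \<rho>) * \<rho> ^ M / (1 - \<rho> ^ M)"
proof (cases "\<rho> = 0")
  case True
  then show ?thesis using assms by (simp add: terminal_eps_def)
next
  case False
  then have "0 < \<rho>" using assms by simp
  then have "\<rho> ^ M \<noteq> 0" by simp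
  have "\<rho> ^ M < 1" using assms by (simp add: power_less_one_iff)
  have "\<rho> powi (- int M) - 1 = (1 - \<rho> ^ M) / \<rho> ^ M"
    using \<open>\<rho> ^ M \<noteq> 0\<close> by (simp add: power_int_minus field_simps)
  then show ?thesis using False by (simp add: terminal_eps_def)
qed

lemma geometric_factor_ge_1:
  fixes \<rho> :: real
  assumes "0 \<le> \<rho>" "\<rho> < 1" "1 \<le> M"
  shows "1 \<le> (1 - \<rho> ^ M) / (1 - \<rho>)"
proof -
  have "\<rho> ^ M \<le> \<rho> ^ 1" using assms by (intro power_decreasing) auto
  then show ?thesis using assms by simp
qed

text \<open>The source of \<open>terminal_eps\<close>: for $C, \rho > 0$ the extremal sequence, with
  equality in the hypothesis, is $a_k = a_M \rho^{k-M} / C$, and it turns the conclusion into an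
  equality too. Multiplying the hypothesis by $\rho^k$ puts a geometric series on the left-hand
  side without dividing by $\rho$.\<close>

lemma terminal_eps_bound:
  fixes a :: "nat \<Rightarrow> real"
  assumes \<rho>: "0 \<le> \<rho>" "\<rho> < 1" and "1 \<le> M"
    and restart: "\<And>k. k < M \<Longrightarrow> a M \<le> C * \<rho> ^ (M - k) * a k"
  shows "a M \<le> terminal_eps C \<rho> M * (\<Sum>k<M. a k)"
proof -
  have pow: "\<rho> ^ M < 1" using assms by (simp add: power_less_one_iff)
  have "a M * \<rho> ^ k \<le> C * \<rho> ^ M * a k" if "k < M" for k
  proof -
    have "a M * \<rho> ^ k \<le> C * \<rho> ^ (M - k) * a k * \<rho> ^ k"
      using restart[OF that] \<rho> by (intro mult_right_mono) auto
    also have "\<dots> = C * (\<rho> ^ (M - k) * \<rho> ^ k) * a k" by (simp add: algebra_simps)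
    also have "\<rho> ^ (M - k) * \<rho> ^ k = \<rho> ^ M" using that by (simp flip: power_add)
    finally show ?thesis .
  qed
  then have "(\<Sum>k<M. a M * \<rho> ^ k) \<le> (\<Sum>k<M. C * \<rho> ^ M * a k)"
    by (intro sum_mono) auto
  then have "a M * (\<Sum>k<M. \<rho> ^ k) \<le> C * \<rho> ^ M * (\<Sum>k<M. a k)"
    by (simp add: sum_distrib_left)
  then have "a M * ((1 - \<rho> ^ M) / (1 - \<rho>)) \<le> C * \<rho> ^ M * (\<Sum>k<M. a k)"
    using \<rho> by (simp add: sum_gp_strict)
  then show ?thesis
    using \<rho> pow assms by (simp add: terminal_eps_eq field_simps)
qed

section \<open>Stage costs along the closed loop\<close>

lemma min_stage_cost_le:
  assumes "\<And>u. u \<in> U \<Longrightarrow> 0 \<le> l x u" "v \<in> U"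
  shows "min_stage_cost U l x \<le> l x v"
  unfolding min_stage_cost_def using assms by (intro cINF_lower bdd_belowI2) auto

definition closed_loop_stage_cost ::
  "('x \<Rightarrow> 'u \<Rightarrow> 'x) \<Rightarrow> ('x \<Rightarrow> 'u \<Rightarrow> real) \<Rightarrow> ('x \<Rightarrow> 'u) \<Rightarrow> 'x \<Rightarrow> nat \<Rightarrow> real" where
  "closed_loop_stage_cost f l \<kappa> x k =
     l (trajectory f (feedback_input f \<kappa> x) x k) (feedback_input f \<kappa> x k)"

text \<open>Time invariance: this is what allows an estimate for all initial states to be restarted at
  an intermediate state.\<close>

lemma closed_loop_stage_cost_shift:
  "closed_loop_stage_cost f l \<kappa> x (i + k) =
     closed_loop_stage_cost f l \<kappa> (trajectory f (feedback_input f \<kappa> x) x k) i"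
  by (simp add: closed_loop_stage_cost_def trajectory_feedback_input feedback_input_def funpow_add)

lemma closed_loop_stage_cost_0: "closed_loop_stage_cost f l \<kappa> x 0 = l x (\<kappa> x)"
  by (simp add: closed_loop_stage_cost_def feedback_input_def)

lemma closed_loop_stage_cost_Suc:
  "closed_loop_stage_cost f l \<kappa> x (Suc k) = closed_loop_stage_cost f l \<kappa> (f x (\<kappa> x)) k"
  using closed_loop_stage_cost_shift[of f l \<kappa> x k 1] by (simp add: feedback_input_def)

lemma feedback_cost_eq_sum:
  "feedback_cost f l \<kappa> M x = (\<Sum>k<M. closed_loop_stage_cost f l \<kappa> x k)"
  by (simp add: feedback_cost_def closed_loop_stage_cost_def)

text \<open>Following the feedback for one step and then paying for $M$ more costs exactly one stage
  beyond the first $M$.\<close>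

lemma feedback_cost_step:
  "feedback_cost f l \<kappa> M (f x (\<kappa> x)) + l x (\<kappa> x) =
     feedback_cost f l \<kappa> M x + closed_loop_stage_cost f l \<kappa> x M"
proof -
  have "feedback_cost f l \<kappa> M (f x (\<kappa> x)) + l x (\<kappa> x) =
      (\<Sum>k<Suc M. closed_loop_stage_cost f l \<kappa> x k)"
    by (simp only: sum.lessThan_Suc_shift)
      (simp add: feedback_cost_eq_sum closed_loop_stage_cost_0 closed_loop_stage_cost_Suc)
  then show ?thesis by (simp add: feedback_cost_eq_sum)
qed

section \<open>The feedback cost as terminal cost\<close>

lemma feedback_cost_ge_min_stage_cost:
  assumes nonneg: "\<And>x u. u \<in> U \<Longrightarrow> 0 \<le> l x u" and \<kappa>: "\<And>x. \<kappa> x \<in> U" and "1 \<le> M"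
  shows "min_stage_cost U l x \<le> feedback_cost f l \<kappa> M x"
proof -
  have "min_stage_cost U l x \<le> closed_loop_stage_cost f l \<kappa> x 0"
    using nonneg \<kappa> by (simp add: closed_loop_stage_cost_0 min_stage_cost_le)
  also have "\<dots> \<le> (\<Sum>k<M. closed_loop_stage_cost f l \<kappa> x k)"
    using nonneg \<kappa> \<open>1 \<le> M\<close>
    by (intro member_le_sum) (auto simp: closed_loop_stage_cost_def feedback_input_eq)
  finally show ?thesis by (simp add: feedback_cost_eq_sum)
qed

lemma feedback_cost_le_min_stage_cost:
  assumes "\<rho> < 1"
    and decay: "\<And>k. closed_loop_stage_cost f l \<kappa> x k \<le> C * \<rho> ^ k * min_stage_cost U l x"
  shows "feedback_cost f l \<kappa> M x \<le> (1 - \<rho> ^ M) / (1 - \<rho>) * C * min_stage_cost U l x"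
proof -
  have "feedback_cost f l \<kappa> M x \<le> (\<Sum>k<M. C * \<rho> ^ k * min_stage_cost U l x)"
    unfolding feedback_cost_eq_sum by (intro sum_mono decay)
  also have "\<dots> = (\<Sum>k<M. \<rho> ^ k) * C * min_stage_cost U l x"
    by (simp add: sum_distrib_left sum_distrib_right mult_ac)
  finally show ?thesis using \<open>\<rho> < 1\<close> by (simp add: sum_gp_strict)
qed

text \<open>The decay estimate is used from each state $x_k$ with the remaining time $M - k$, and
  $\sigma(x_k)$ is then replaced by the larger cost actually paid there.\<close>

lemma feedback_cost_descent:
  assumes nonneg: "\<And>x u. u \<in> U \<Longrightarrow> 0 \<le> l x u" and \<kappa>: "\<And>x. \<kappa> x \<in> U"
    and "0 \<le> C" and \<rho>: "0 \<le> \<rho>" "\<rho> < 1"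
    and decay: "\<And>x k. closed_loop_stage_cost f l \<kappa> x k \<le> C * \<rho> ^ k * min_stage_cost U l x"
    and M: "1 \<le> M"
  shows "feedback_cost f l \<kappa> M (f x (\<kappa> x)) + l x (\<kappa> x)
    \<le> (1 + terminal_eps C \<rho> M) * feedback_cost f l \<kappa> M x"
proof -
  have "closed_loop_stage_cost f l \<kappa> x M
      \<le> C * \<rho> ^ (M - k) * closed_loop_stage_cost f l \<kappa> x k" if "k < M" for k
  proof -
    define y where "y = trajectory f (feedback_input f \<kappa> x) x k"
    have "closed_loop_stage_cost f l \<kappa> x M = closed_loop_stage_cost f l \<kappa> y (M - k)"
      using closed_loop_stage_cost_shift[of f l \<kappa> x "M - k" k] that by (simp add: y_def)
    also have "\<dots> \<le> C * \<rho> ^ (M - k) * min_stage_cost U l y" by (rule decay)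
    also have "\<dots> \<le> C * \<rho> ^ (M - k) * closed_loop_stage_cost f l \<kappa> y 0"
      using nonneg \<kappa> \<open>0 \<le> C\<close> \<rho>
      by (intro mult_left_mono) (simp_all add: closed_loop_stage_cost_0 min_stage_cost_le)
    also have "closed_loop_stage_cost f l \<kappa> y 0 = closed_loop_stage_cost f l \<kappa> x k"
      using closed_loop_stage_cost_shift[of f l \<kappa> x 0 k] by (simp add: y_def)
    finally show ?thesis .
  qed
  then have "closed_loop_stage_cost f l \<kappa> x M
      \<le> terminal_eps C \<rho> M * feedback_cost f l \<kappa> M x"
    unfolding feedback_cost_eq_sum by (intro terminal_eps_bound \<rho> M)
  then show ?thesis unfolding feedback_cost_step by (simp add: algebra_simps)
qed

text \<open>For horizon $1$ only the first input matters, so an optimal input sequence amounts to an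
  optimal input, and the infimum defining the value is attained there.\<close>

lemma one_step_minimizer:
  assumes "minimizers_exist f U l Vf"
  obtains u where "is_arg_min (\<lambda>v. Vf (f x v) + l x v) (\<lambda>v. v \<in> U) u"
    and "horizon_value f U l Vf 1 x = Vf (f x u) + l x u"
proof -
  obtain w where w: "is_arg_min (horizon_cost f l Vf 1 x) (\<lambda>u. u \<in> input_seqs U 1) w"
    using assms unfolding minimizers_exist_def by blast
  have cost: "horizon_cost f l Vf 1 x u = Vf (f x (u 0)) + l x (u 0)" for u
    by (simp add: horizon_cost_def)
  have w_in: "w \<in> input_seqs U 1"
    using w by (simp add: is_arg_min_linorder)
  have w_le: "horizon_cost f l Vf 1 x w \<le> horizon_cost f l Vf 1 x u" if "u \<in> input_seqs U 1" for u
    using w that by (simp add: is_arg_min_linorder)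
  have "is_arg_min (\<lambda>v. Vf (f x v) + l x v) (\<lambda>v. v \<in> U) (w 0)"
    unfolding is_arg_min_linorder
  proof (intro conjI allI impI)
    show "w 0 \<in> U" using w_in by (auto simp: input_seqs_def)
  next
    fix v assume "v \<in> U"
    then show "Vf (f x (w 0)) + l x (w 0) \<le> Vf (f x v) + l x v"
      using w_le[of "\<lambda>_. v"] unfolding cost by (simp add: input_seqs_def)
  qed
  moreover have "horizon_value f U l Vf 1 x = horizon_cost f l Vf 1 x w"
    unfolding horizon_value_def using w_in w_le by (intro cInf_eq_minimum) auto
  ultimately show thesis using that cost by metis
qed

text \<open>Cost controllability constrains each horizon separately, so the constant of one horizon may
  be exchanged; the common bound is enlarged if necessary.\<close>

lemma cost_controllability_update:
  assumes "cost_controllability f U l Vf \<sigma> \<gamma>bar \<gamma>" "0 \<le> c"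
    and "\<And>x. horizon_value f U l Vf n x \<le> c * \<sigma> x"
  shows "cost_controllability f U l Vf \<sigma> (max \<gamma>bar c) (\<gamma>(n := c))"
  using assms by (auto simp: cost_controllability_def le_max_iff_disj)

section \<open>The terminal cost condition\<close>

theorem proposition3:
  fixes f :: "real ^ 'n \<Rightarrow> real ^ 'm \<Rightarrow> real ^ 'n"
    and U :: "(real ^ 'm) set"
    and l :: "real ^ 'n \<Rightarrow> real ^ 'm \<Rightarrow> real"
    and \<kappa> :: "real ^ 'n \<Rightarrow> real ^ 'm"
    and C \<rho> \<gamma>bar :: real and \<gamma> :: "nat \<Rightarrow> real" and M :: nat
    and \<sigma> Vf :: "real ^ 'n \<Rightarrow> real"
    and c_up c_low \<epsilon> :: real
  defines "\<sigma> \<equiv> min_stage_cost U l"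
    and "Vf \<equiv> feedback_cost f l \<kappa> M"
    and "c_up \<equiv> (1 - \<rho> ^ M) / (1 - \<rho>) * C"
    and "c_low \<equiv> 1"
    and "\<epsilon> \<equiv> terminal_eps C \<rho> M"
  assumes stage_cost_nonneg: "\<And>x u. u \<in> U \<Longrightarrow> 0 \<le> l x u"
    and feedback_in_U: "\<And>x. \<kappa> x \<in> U"
    and C: "1 \<le> C"
    and \<rho>: "0 \<le> \<rho>" "\<rho> < 1"
    and decay: "\<And>x k. l (trajectory f (feedback_input f \<kappa> x) x k) (feedback_input f \<kappa> x k)
                        \<le> C * \<rho> ^ k * min_stage_cost U l x"
    and M: "1 \<le> M"
    and minimizers: "minimizers_exist f U l Vf"
    and controllability: "cost_controllability f U l Vf \<sigma> \<gamma>bar \<gamma>"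
  shows "0 < c_low \<and> 0 < c_up \<and> 0 \<le> \<epsilon> \<and> (0 < \<rho> \<longrightarrow> 0 < \<epsilon>)
    \<and> (\<forall>x. c_low * \<sigma> x \<le> Vf x \<and> Vf x \<le> c_up * \<sigma> x)
    \<and> (\<forall>x. \<exists>u. is_arg_min (\<lambda>v. Vf (f x v) + l x v) (\<lambda>v. v \<in> U) u
              \<and> Vf (f x u) + l x u \<le> (1 + \<epsilon>) * Vf x)
    \<and> (\<exists>\<gamma>bar' \<gamma>'. cost_controllability f U l Vf \<sigma> \<gamma>bar' \<gamma>'
              \<and> (\<forall>k\<ge>2. \<gamma>' k = \<gamma> k)
              \<and> (c_low \<le> \<gamma> 1 / (1 + \<epsilon>) \<and> \<gamma> 1 / (1 + \<epsilon>) \<le> c_up \<longrightarrow> \<gamma>' 1 = \<gamma> 1)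
              \<and> c_low \<le> \<gamma>' 1 / (1 + \<epsilon>) \<and> \<gamma>' 1 / (1 + \<epsilon>) \<le> c_up)"
proof -
  have decay': "closed_loop_stage_cost f l \<kappa> x k \<le> C * \<rho> ^ k * min_stage_cost U l x" for x k
    using decay by (simp add: closed_loop_stage_cost_def)
  have pow: "\<rho> ^ M < 1" using \<rho> M by (simp add: power_less_one_iff)
  have \<epsilon>_eq: "\<epsilon> = C * (1 - \<rho>) * \<rho> ^ M / (1 - \<rho> ^ M)"
    unfolding \<epsilon>_def using \<rho> M by (rule terminal_eps_eq)
  have \<epsilon>_nonneg: "0 \<le> \<epsilon>" and \<epsilon>_pos: "0 < \<rho> \<longrightarrow> 0 < \<epsilon>"
    using C \<rho> pow by (simp_all add: \<epsilon>_eq)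
  have c_up_ge_1: "1 \<le> c_up"
    unfolding c_up_def using mult_mono[OF geometric_factor_ge_1[OF \<rho> M] C] C \<rho> pow by simp
  have lower: "\<sigma> x \<le> Vf x" for x
    unfolding \<sigma>_def Vf_def
    using stage_cost_nonneg feedback_in_U M by (rule feedback_cost_ge_min_stage_cost)
  have upper: "Vf x \<le> c_up * \<sigma> x" for x
    unfolding \<sigma>_def Vf_def c_up_def using \<rho>(2) decay' by (rule feedback_cost_le_min_stage_cost)
  have descent: "Vf (f x (\<kappa> x)) + l x (\<kappa> x) \<le> (1 + \<epsilon>) * Vf x" for x
    unfolding Vf_def \<epsilon>_def
    using stage_cost_nonneg feedback_in_U _ \<rho> decay' M
    by (rule feedback_cost_descent) (use C in auto)
  have minimum: "\<exists>u. is_arg_min (\<lambda>v. Vf (f x v) + l x v) (\<lambda>v. v \<in> U) u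
      \<and> Vf (f x u) + l x u \<le> (1 + \<epsilon>) * Vf x
      \<and> horizon_value f U l Vf 1 x = Vf (f x u) + l x u" for x
  proof -
    obtain u where u: "is_arg_min (\<lambda>v. Vf (f x v) + l x v) (\<lambda>v. v \<in> U) u"
      "horizon_value f U l Vf 1 x = Vf (f x u) + l x u"
      using one_step_minimizer[OF minimizers] .
    then have "Vf (f x u) + l x u \<le> Vf (f x (\<kappa> x)) + l x (\<kappa> x)"
      using feedback_in_U by (auto simp: is_arg_min_linorder)
    with descent[of x] u show ?thesis by fastforce
  qed
  have value_le: "horizon_value f U l Vf 1 x \<le> ((1 + \<epsilon>) * c_up) * \<sigma> x" for x
  proof -
    have "horizon_value f U l Vf 1 x \<le> (1 + \<epsilon>) * Vf x" using minimum[of x] by auto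
    also have "\<dots> \<le> (1 + \<epsilon>) * (c_up * \<sigma> x)"
      using upper[of x] \<epsilon>_nonneg by (intro mult_left_mono) auto
    finally show ?thesis by (simp add: mult.assoc)
  qed
  have constants: "\<exists>\<gamma>bar' \<gamma>'. cost_controllability f U l Vf \<sigma> \<gamma>bar' \<gamma>'
      \<and> (\<forall>k\<ge>2. \<gamma>' k = \<gamma> k)
      \<and> (c_low \<le> \<gamma> 1 / (1 + \<epsilon>) \<and> \<gamma> 1 / (1 + \<epsilon>) \<le> c_up \<longrightarrow> \<gamma>' 1 = \<gamma> 1)
      \<and> c_low \<le> \<gamma>' 1 / (1 + \<epsilon>) \<and> \<gamma>' 1 / (1 + \<epsilon>) \<le> c_up"
  proof (cases "c_low \<le> \<gamma> 1 / (1 + \<epsilon>) \<and> \<gamma> 1 / (1 + \<epsilon>) \<le> c_up")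
    case True
    with controllability show ?thesis by blast
  next
    case False
    define c where "c = (1 + \<epsilon>) * c_up"
    have "0 \<le> c" using \<epsilon>_nonneg c_up_ge_1 by (simp add: c_def)
    then have "cost_controllability f U l Vf \<sigma> (max \<gamma>bar c) (\<gamma>(1 := c))"
      using controllability value_le by (intro cost_controllability_update) (simp_all add: c_def)
    moreover have "c / (1 + \<epsilon>) = c_up" using \<epsilon>_nonneg by (simp add: c_def)
    ultimately show ?thesis
      using False c_up_ge_1
      by (intro exI[of _ "max \<gamma>bar c"] exI[of _ "\<gamma>(1 := c)"]) (auto simp: c_low_def)
  qed
  have "0 < c_low" by (simp add: c_low_def)
  moreover have "0 < c_up" using c_up_ge_1 by simp
  moreover have "\<forall>x. c_low * \<sigma> x \<le> Vf x \<and> Vf x \<le> c_up * \<sigma> x"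
    using lower upper by (simp add: c_low_def)
  moreover have "\<forall>x. \<exists>u. is_arg_min (\<lambda>v. Vf (f x v) + l x v) (\<lambda>v. v \<in> U) u
      \<and> Vf (f x u) + l x u \<le> (1 + \<epsilon>) * Vf x"
    using minimum by blast
  ultimately show ?thesis using \<epsilon>_nonneg \<epsilon>_pos constants by blast
qed

end
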